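(* Let $G$ be a connected, reduced bipartite graph with partite sets of sizes $m$ and $n$, where $m\le n$. Then: (1) if $n\ge m+3$, then $\mathcal{R}(G)\le \lceil \frac{m+n}{4}\rceil$; (2) if $m$ is even and $n\in\{m+1,m+2\}$, then $\mathcal{R}(G)\le \lceil \frac{m+n}{4}\rceil$.
   Context: Letters $x,y$ alternate in a word $w$ if the subsequence of $w$ consisting of occurrences of $x$ and $y$ is $xyxy\cdots$ or $yxyx\cdots$. A word $w$ over the vertex set of a graph (containing every vertex) represents the graph if two vertices are adjacent iff they alternate in $w$. A word is $k$-uniform if each letter occurs exactly $k$ times. The representation number $\mathcal{R}(G)$ is the least $k$ such that $G$ has a $k$-uniform word representing it. A graph is reduced if no two vertices have the same neighborhood. *)

theory Defs
  imports
    Complex_Main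
    "HOL-Library.Extended_Nat"
    "Graph_Theory.Digraph_Component"
begin

text \<open>
  A finite simple graph is a structure satisfying the locale \<^locale>\<open>graph\<close>: a finite symmetric
  digraph without loops and parallel arcs. Vertices \<open>x\<close> and \<open>y\<close> are adjacent if
  \<open>(x, y) \<in> arcs_ends G\<close>.
\<close>

definition neighborhood :: "('a, 'b) pre_digraph \<Rightarrow> 'a \<Rightarrow> 'a set" where
  "neighborhood G v = {u \<in> verts G. v \<rightarrow>\<^bsub>G\<^esub> u}"

definition reduced :: "('a, 'b) pre_digraph \<Rightarrow> bool" where
  "reduced G \<longleftrightarrow>
     (\<forall>u \<in> verts G. \<forall>v \<in> verts G. u \<noteq> v \<longrightarrow> neighborhood G u \<noteq> neighborhood G v)"

definition bipartition :: "('a, 'b) pre_digraph \<Rightarrow> 'a set \<Rightarrow> 'a set \<Rightarrow> bool" where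
  "bipartition G A B \<longleftrightarrow>
     verts G = A \<union> B \<and> A \<inter> B = {} \<and>
     (\<forall>u v. u \<rightarrow>\<^bsub>G\<^esub> v \<longrightarrow> (u \<in> A \<and> v \<in> B) \<or> (u \<in> B \<and> v \<in> A))"

text \<open>\<open>alternating_word x y n\<close> is the word \<open>xyxy\<dots>\<close> of length \<open>n\<close>.\<close>

fun alternating_word :: "'a \<Rightarrow> 'a \<Rightarrow> nat \<Rightarrow> 'a list" where
  "alternating_word x y 0 = []"
| "alternating_word x y (Suc n) = x # alternating_word y x n"

definition alternate :: "'a \<Rightarrow> 'a \<Rightarrow> 'a list \<Rightarrow> bool" where
  "alternate x y w \<longleftrightarrow>
     (\<exists>n. filter (\<lambda>z. z = x \<or> z = y) w = alternating_word x y n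
        \<or> filter (\<lambda>z. z = x \<or> z = y) w = alternating_word y x n)"

definition represents :: "'a list \<Rightarrow> ('a, 'b) pre_digraph \<Rightarrow> bool" where
  "represents w G \<longleftrightarrow>
     set w = verts G \<and>
     (\<forall>x \<in> verts G. \<forall>y \<in> verts G. x \<noteq> y \<longrightarrow> (x \<rightarrow>\<^bsub>G\<^esub> y \<longleftrightarrow> alternate x y w))"

definition uniform_word :: "nat \<Rightarrow> 'a list \<Rightarrow> bool" where
  "uniform_word k w \<longleftrightarrow> (\<forall>x \<in> set w. count_list w x = k)"

text \<open>
  The value is \<open>\<infinity>\<close> if no uniform word represents the graph, so a finite upper bound includes
  the existence of a representing word. As \<^typ>\<open>enat\<close> is well-ordered, the infimum of a
  nonempty set is its least element.
\<close>

definition representation_number :: "('a, 'b) pre_digraph \<Rightarrow> enat" where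
  "representation_number G = Inf {enat k | k. \<exists>w. uniform_word k w \<and> represents w G}"

end

theory Submission
  imports Defs
begin

text \<open>
  If the smaller part has at most \<open>2t\<close> vertices, \<open>t \<ge> 1\<close>, then there is a representing word with
  \<open>t + 1\<close> copies of every letter, whatever the other part is; this is within the bound in both
  cases. Group the smaller part into pairs \<open>x\<^sub>j y\<^sub>j\<close> with \<open>j < t\<close> and write it as \<open>t + 1\<close> permutations
  such that the \<open>j\<close>-th one ends with \<open>x\<^sub>j y\<^sub>j\<close> and the next one begins with \<open>x\<^sub>j y\<^sub>j\<close>. A vertex \<open>b\<close> of
  the other part is written once around each of the \<open>t\<close> borders \<open>x\<^sub>j y\<^sub>j | x\<^sub>j y\<^sub>j\<close>, and once at the
  very beginning. At the border itself \<open>b\<close> alternates with both letters; placed before both it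
  leaves the two copies of each letter unseparated, and placed inside the left or the right pair
  it fails to separate only the \<open>y\<^sub>j\<close> or only the \<open>x\<^sub>j\<close>, respectively. So all four adjacency
  patterns with a pair can be realised at its border. The initial row of the other part reverses
  its order at the first border, so that no two of its vertices alternate.

  For \<open>t = 1\<close> this would make \<open>x\<^sub>0\<close> and \<open>y\<^sub>0\<close> alternate, and a separate word is used. If the
  smaller part is empty, reducedness forces the graph to be a single vertex.
\<close>

section \<open>Alternating words and repeated letters\<close>

lemma alternate_commute: "alternate x y w \<longleftrightarrow> alternate y x w"
proof -
  have "(\<lambda>z. z = x \<or> z = y) = (\<lambda>z. z = y \<or> z = x)" by auto
  then show ?thesis unfolding alternate_def by auto
qed

lemma map_alternating_word:
  "map f (alternating_word x y n) = alternating_word (f x) (f y) n"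
  by (induction n arbitrary: x y) auto

lemma alternating_word_no_square:
  "x \<noteq> y \<Longrightarrow> alternating_word x y n \<noteq> u @ c # c # v"
proof (induction n arbitrary: x y u)
  case (Suc n)
  show ?case
  proof
    assume *: "alternating_word x y (Suc n) = u @ c # c # v"
    show False
    proof (cases u)
      case Nil
      with * Suc.prems show False by (cases n) auto
    next
      case (Cons d u')
      with * have "alternating_word y x n = u' @ c # c # v" by auto
      with Suc.IH[of y x u'] Suc.prems show False by simp
    qed
  qed
qed simp

text \<open>Every non-adjacency below is obtained from this criterion: it suffices to exhibit two
  equal neighbouring letters in the restriction to the two vertices.\<close>

lemma not_alternate_if_square:
  assumes "x \<noteq> y" "filter (\<lambda>z. z = x \<or> z = y) w = u @ c # c # v"
  shows "\<not> alternate x y w"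
  using assms alternating_word_no_square[of x y] alternating_word_no_square[of y x]
  unfolding alternate_def by (metis (no_types, lifting))

lemma alternating_word_even:
  "alternating_word x y (2 * n) = concat (replicate n [x, y])"
  by (induction n) auto

lemma append_alternating_word_even:
  "concat (replicate n [x, y]) @ alternating_word x y k = alternating_word x y (2 * n + k)"
  by (induction n) auto

section \<open>Counting, filtering and renaming letters\<close>

lemma count_list_filter_eq: "P x \<Longrightarrow> count_list (filter P w) x = count_list w x"
  by (induction w) auto

lemma concat_replicate_Suc: "concat (replicate (Suc n) xs) = concat (replicate n xs) @ xs"
  by (induction n) auto

lemma count_list_concat_replicate:
  "count_list (concat (replicate n xs)) x = n * count_list xs x"
  by (induction n) (auto simp: count_list_append)

lemma filter_eq_singleton:
  assumes "distinct xs"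
  shows "filter (\<lambda>z. z = x \<and> Q z) xs = (if x \<in> set xs \<and> Q x then [x] else [])"
  using assms by (induction xs) auto

lemma concat_map_unique:
  assumes "distinct xs" "\<And>i. i \<in> set xs \<Longrightarrow> i \<noteq> j \<Longrightarrow> f i = []"
  shows "concat (map f xs) = (if j \<in> set xs then f j else [])"
  using assms by (induction xs) auto

lemma concat_map_const:
  assumes "\<And>i. i \<in> set xs \<Longrightarrow> f i = c"
  shows "concat (map f xs) = concat (replicate (length xs) c)"
  using assms by (induction xs) auto

text \<open>Regrouping of \<open>Q a, R a, Q (a + 1), ..., Q c\<close>: each \<open>R\<close> is
  paired with the \<open>Q\<close> after it instead of the one before it.\<close>

lemma concat_shift:
  assumes "a \<le> (c::nat)"
  shows "concat (map (\<lambda>i. Q i @ R i) [a..<c]) @ Q c =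
         Q a @ concat (map (\<lambda>i. R i @ Q (Suc i)) [a..<c])"
  using assms by (induction c rule: dec_induct) auto

text \<open>The seam shows one surviving letter on both sides: the first one of \<open>w\<close> in
  \<open>rev w @ w\<close>, the last one in \<open>w @ rev w\<close>.\<close>

lemma filter_rev_append_self:
  assumes "x \<in> set w" "P x"
  shows "\<exists>u c v. filter P (rev w @ w) = u @ c # c # v" "\<exists>u c v. filter P (w @ rev w) = u @ c # c # v"
proof -
  have "filter P w \<noteq> []" using assms by (auto simp: filter_empty_conv)
  then obtain c v where "filter P w = c # v" by (auto simp: neq_Nil_conv)
  then have "filter P (rev w @ w) = rev v @ c # c # v" by (simp flip: rev_filter)
  then show "\<exists>u c v. filter P (rev w @ w) = u @ c # c # v" by blast
  obtain d u where "filter P w = u @ [d]" using \<open>filter P w \<noteq> []\<close> by (metis rev_exhaust)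
  then have "filter P (w @ rev w) = u @ d # d # rev u" by (simp flip: rev_filter)
  then show "\<exists>u c v. filter P (w @ rev w) = u @ c # c # v" by blast
qed

text \<open>Letters outside the image of \<open>g\<close> are deleted and the others renamed back to
  vertices. Alternation depends only on the restriction to two letters, so neither operation affects
  it. This disposes of dummy letters.\<close>

lemma represents_transfer:
  fixes g :: "'a \<Rightarrow> 'c" and G :: "('a, 'b) pre_digraph"
  assumes inj: "inj_on g (verts G)"
    and k: "k > 0"
    and count: "\<And>x. x \<in> verts G \<Longrightarrow> count_list w (g x) = k"
    and alt: "\<And>x y. x \<in> verts G \<Longrightarrow> y \<in> verts G \<Longrightarrow> x \<noteq> y \<Longrightarrow>
                x \<rightarrow>\<^bsub>G\<^esub> y \<longleftrightarrow> alternate (g x) (g y) w"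
  shows "\<exists>w'. uniform_word k w' \<and> represents w' G"
proof -
  let ?V = "verts G"
  define h where "h = inv_into ?V g"
  define w' where "w' = map h (filter (\<lambda>z. z \<in> g ` ?V) w)"
  have hg: "h (g x) = x" if "x \<in> ?V" for x using inj that by (simp add: h_def)
  have filt: "filter P w' = map h (filter (\<lambda>z. z \<in> g ` ?V \<and> P (h z)) w)" for P
    unfolding w'_def by (auto simp: filter_map o_def intro!: arg_cong[where f = "map h"] filter_cong)
  have cnt: "count_list w' x = k" if x: "x \<in> ?V" for x
  proof -
    have "count_list w' x = length (filter (\<lambda>z. z = x) w')"
      by (induction w') auto
    also have "\<dots> = length (filter (\<lambda>z. z = g x) w)"
      unfolding filt length_map
      by (rule arg_cong[where f = length], rule filter_cong) (use x hg in auto)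
    also have "\<dots> = count_list w (g x)" by (induction w) auto
    finally show ?thesis using count[OF x] by simp
  qed
  have "set w' \<subseteq> ?V" using hg by (auto simp: w'_def)
  moreover have "?V \<subseteq> set w'"
  proof
    fix x assume "x \<in> ?V"
    with cnt k have "count_list w' x \<noteq> 0" by simp
    then show "x \<in> set w'" by (simp add: count_list_0_iff)
  qed
  ultimately have set: "set w' = ?V" by auto
  have "alternate x y w' \<longleftrightarrow> alternate (g x) (g y) w" if xy: "x \<in> ?V" "y \<in> ?V" for x y
  proof -
    let ?F = "filter (\<lambda>z. z = g x \<or> z = g y) w"
    have 1: "filter (\<lambda>z. z = x \<or> z = y) w' = map h ?F"
      unfolding filt
      by (rule arg_cong[where f = "map h"], rule filter_cong) (use xy hg in auto)
    \<comment> \<open>On the letters \<open>g x\<close> and \<open>g y\<close> the map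
      \<open>g\<close> undoes \<open>h\<close>, so an alternating form can be carried in both
      directions.\<close>
    have 2: "?F = map g (map h ?F)"
      unfolding map_map by (rule map_idI[symmetric]) (use xy hg in auto)
    show ?thesis unfolding alternate_def 1
      by (metis (no_types, lifting) 2 map_alternating_word hg xy)
  qed
  then have "represents w' G" using alt set by (auto simp: represents_def)
  moreover have "uniform_word k w'" using cnt set by (auto simp: uniform_word_def)
  ultimately show ?thesis by blast
qed

text \<open>
  The two letters of the \<open>j\<close>-th pair are \<open>x\<^sub>j = Inl (j, False)\<close> and \<open>y\<^sub>j = Inl (j, True)\<close>. Using
  abstract letters leaves room for a dummy one when the smaller part has odd size.
\<close>

type_synonym 'b letter = "(nat \<times> bool) + 'b"

section \<open>The two words and their building blocks\<close>

context
  fixes E :: "nat \<times> bool \<Rightarrow> 'b \<Rightarrow> bool" and bs :: "'b list"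
begin

definition cell :: "nat \<Rightarrow> bool \<Rightarrow> bool \<Rightarrow> 'b letter list" where
  "cell j p q = map Inr (filter (\<lambda>b. E (j, False) b = p \<and> E (j, True) b = q) bs)"

definition gap :: "nat \<Rightarrow> 'b letter list" where
  "gap j = cell j False False @ [Inl (j, False)] @ cell j True False @ [Inl (j, True)] @
           cell j True True @ [Inl (j, False)] @ cell j False True @ [Inl (j, True)]"

text \<open>The inner part of the \<open>i\<close>-th permutation: pairs \<open>i - 1\<close> and
  \<open>i\<close> are left out because the adjacent gaps supply them. The order \<open>y, x\<close>
  is opposite to the one in \<open>gap\<close>, which later keeps the two letters of a pair from
  alternating.\<close>

definition others :: "nat \<Rightarrow> nat \<Rightarrow> 'b letter list" where
  "others t i =
     concat (map (\<lambda>j. if j = i \<or> Suc j = i then [] else [Inl (j, True), Inl (j, False)]) [0..<t])"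

definition gap_word :: "nat \<Rightarrow> 'b letter list" where
  "gap_word t =
     rev (cell 0 False False @ cell 0 True False @ cell 0 True True @ cell 0 False True) @
     concat (map (\<lambda>i. others t i @ gap i) [0..<t]) @ others t t"

text \<open>The word for a single pair. Its pair letters read \<open>x x y y\<close>; each cell
  stands around one \<open>x\<close>, around the inner \<open>x y\<close>, around one
  \<open>y\<close>, or after everything, according to its adjacency pattern, and returns
  reversed.\<close>

definition small_word :: "'b letter list" where
  "small_word =
     cell 0 True False @ [Inl (0, False)] @ rev (cell 0 True False) @
     cell 0 True True @ [Inl (0, False), Inl (0, True)] @ rev (cell 0 True True) @
     cell 0 False True @ [Inl (0, True)] @ rev (cell 0 False True) @
     cell 0 False False @ rev (cell 0 False False)"

section \<open>Restriction of the blocks to few letters\<close>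

lemma filter_others:
  "filter P (others t i) =
     concat (map (\<lambda>j. if j = i \<or> Suc j = i then []
       else filter P [Inl (j, True), Inl (j, False)]) [0..<t])"
  unfolding others_def filter_concat map_map
  by (intro arg_cong[where f = concat] map_cong) auto

lemma filter_others_pair:
  assumes "j < t" "\<And>i s. i \<noteq> j \<Longrightarrow> \<not> P (Inl (i, s))"
  shows "filter P (others t i) =
    (if j = i \<or> Suc j = i then [] else filter P [Inl (j, True), Inl (j, False)])"
  unfolding filter_others
  by (subst concat_map_unique[where j = j]) (use assms in auto)

lemma filter_others_Nil:
  assumes "\<And>p. \<not> P (Inl p)"
  shows "filter P (others t i) = []"
  using assms by (auto simp: others_def filter_empty_conv)

lemma filter_cell_Nil:
  assumes "\<And>b. \<not> P (Inr b)"
  shows "filter P (cell j p q) = []"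
  using assms by (auto simp: cell_def filter_empty_conv)

lemma filter_cell:
  assumes "distinct bs" "b \<in> set bs" "\<And>c. P (Inr c) \<longleftrightarrow> c = b"
  shows "filter P (cell j p q) =
    (if E (j, False) b = p \<and> E (j, True) b = q then [Inr b] else [])"
proof -
  let ?Q = "\<lambda>c. E (j, False) c = p \<and> E (j, True) c = q"
  have "filter P (cell j p q) = map Inr (filter (\<lambda>c. c = b \<and> ?Q c) bs)"
    unfolding cell_def filter_map filter_filter o_def assms(3)
    by (rule arg_cong[where f = "map Inr"], rule filter_cong) auto
  then show ?thesis using filter_eq_singleton[OF assms(1), of b ?Q] assms(2) by simp
qed

lemma filter_cell_Inl_Inr:
  assumes "distinct bs" "b \<in> set bs"
  shows "filter (\<lambda>z. z = Inl x \<or> z = Inr b) (cell j p q) =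
    (if E (j, False) b = p \<and> E (j, True) b = q then [Inr b] else [])"
  by (rule filter_cell) (use assms in auto)

section \<open>Multiplicities and alternation in the gap word\<close>

text \<open>Isolates the border of pair \<open>j\<close>. Blocks to its right are regrouped to start
  with a gap, so that on either side all blocks have the same restriction to a letter of the pair
  and a vertex.\<close>

lemma gap_word_split:
  assumes "j < t"
  shows "gap_word t =
     rev (cell 0 False False @ cell 0 True False @ cell 0 True True @ cell 0 False True) @
     concat (map (\<lambda>i. others t i @ gap i) [0..<j]) @ others t j @ gap j @ others t (Suc j) @
     concat (map (\<lambda>i. gap i @ others t (Suc i)) [Suc j..<t])"
proof -
  have "[0..<t] = [0..<j] @ j # [Suc j..<t]"
    using assms upt_add_eq_append[of 0 j "t - j"] by (simp add: upt_conv_Cons)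
  then show ?thesis
    using concat_shift[of "Suc j" t "others t" gap] assms by (simp add: gap_word_def)
qed

text \<open>Away from its own border a pair letter occurs once in each permutation and the vertex
  once in each gap, so they alternate there. Whether they alternate in the whole word is thus
  decided by \<open>gap j\<close>.\<close>

lemma filter_gap_word_Inl_Inr:
  fixes j :: nat and s :: bool
  assumes bs: "distinct bs" "b \<in> set bs" and j: "j < t"
  defines "a \<equiv> Inl (j, s)"
  shows "filter (\<lambda>z. z = a \<or> z = Inr b) (gap_word t) =
    Inr b # concat (replicate j [a, Inr b]) @ filter (\<lambda>z. z = a \<or> z = Inr b) (gap j) @
    concat (replicate (t - Suc j) [Inr b, a])"
proof -
  let ?P = "\<lambda>z. z = a \<or> z = Inr b"
  note c = filter_cell_Inl_Inr[OF bs]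
  have o: "filter ?P (others t i) = (if j = i \<or> Suc j = i then [] else [a])" for i
    by (subst filter_others_pair[of j]) (use j a_def in auto)
  have g: "filter ?P (gap i) = [Inr b]" if "i \<noteq> j" for i
    using that by (auto simp: gap_def c a_def)
  have 1: "filter ?P (concat (map (\<lambda>i. others t i @ gap i) [0..<j])) =
      concat (replicate j [a, Inr b])"
    unfolding filter_concat map_map
    by (subst concat_map_const[where c = "[a, Inr b]"]) (auto simp: o g)
  have 2: "filter ?P (concat (map (\<lambda>i. gap i @ others t (Suc i)) [Suc j..<t])) =
      concat (replicate (t - Suc j) [Inr b, a])"
    unfolding filter_concat map_map
    by (subst concat_map_const[where c = "[Inr b, a]"]) (auto simp: o g)
  have 3: "filter ?P (rev (cell 0 False False @ cell 0 True False @ cell 0 True True @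
      cell 0 False True)) = [Inr b]"
    by (auto simp: c a_def simp flip: rev_filter)
  show ?thesis
    unfolding gap_word_split[OF j] filter_append 1 2 3 by (simp add: o)
qed

lemma filter_gap_Inl_Inr:
  fixes j :: nat and s :: bool
  assumes bs: "distinct bs" "b \<in> set bs"
  defines "a \<equiv> Inl (j, s)"
  obtains "E (j, s) b" "filter (\<lambda>z. z = a \<or> z = Inr b) (gap j) = [a, Inr b, a]"
  | "\<not> E (j, s) b" "filter (\<lambda>z. z = a \<or> z = Inr b) (gap j) \<in> {[Inr b, a, a], [a, a, Inr b]}"
proof -
  let ?P = "\<lambda>z. z = a \<or> z = Inr b"
  note c = filter_cell_Inl_Inr[OF bs]
  show ?thesis
    using that by (cases s; cases "E (j, False) b"; cases "E (j, True) b") (auto simp: gap_def c a_def)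
qed

text \<open>The initial row adds one copy of the vertex to those at the \<open>t\<close> borders. A
  pair letter occurs twice at its own border and once in each of the \<open>t - 1\<close>
  permutations not touching it.\<close>

lemma count_gap_word:
  assumes bs: "distinct bs" "b \<in> set bs" and j: "j < t"
  shows "count_list (gap_word t) (Inl (j, s)) = t + 1" "count_list (gap_word t) (Inr b) = t + 1"
proof -
  let ?P = "\<lambda>z. z = Inl (j, s) \<or> z = Inr b"
  have "count_list (filter ?P (gap j)) (Inl (j, s)) = 2 \<and> count_list (filter ?P (gap j)) (Inr b) = 1"
    by (rule filter_gap_Inl_Inr[OF bs, of j s]) auto
  then have "count_list (filter ?P (gap_word t)) (Inl (j, s)) = t + 1 \<and>
      count_list (filter ?P (gap_word t)) (Inr b) = t + 1"
    unfolding filter_gap_word_Inl_Inr[OF bs j] using j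
    by (simp add: count_list_append count_list_concat_replicate del: filter_append)
  then show "count_list (gap_word t) (Inl (j, s)) = t + 1" "count_list (gap_word t) (Inr b) = t + 1"
    by (simp_all add: count_list_filter_eq)
qed

lemma alternate_gap_word_iff:
  assumes bs: "distinct bs" "b \<in> set bs" and j: "j < t"
  shows "alternate (Inl (j, s)) (Inr b) (gap_word t) \<longleftrightarrow> E (j, s) b"
proof -
  let ?a = "Inl (j, s)" and ?P = "\<lambda>z. z = Inl (j, s) \<or> z = Inr b"
  note f = filter_gap_word_Inl_Inr[OF bs j, of s]
  show ?thesis
  proof (rule filter_gap_Inl_Inr[OF bs, of j s])
    assume E: "E (j, s) b" and g: "filter ?P (gap j) = [?a, Inr b, ?a]"
    \<comment> \<open>The 3 counts the letters at the border itself; the blocks after it contribute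
      two letters each.\<close>
    have "filter ?P (gap_word t) =
        Inr b # concat (replicate j [?a, Inr b]) @ alternating_word ?a (Inr b) (3 + 2 * (t - Suc j))"
      unfolding f g by (simp add: numeral_3_eq_3 alternating_word_even)
    also have "\<dots> = alternating_word (Inr b) ?a (Suc (2 * j + (3 + 2 * (t - Suc j))))"
      unfolding append_alternating_word_even by (simp only: alternating_word.simps)
    finally show ?thesis using E unfolding alternate_def by blast
  next
    assume E: "\<not> E (j, s) b" and g: "filter ?P (gap j) \<in> {[Inr b, ?a, ?a], [?a, ?a, Inr b]}"
    then have "filter ?P (gap j) = [Inr b] @ ?a # ?a # [] \<or> filter ?P (gap j) = [] @ ?a # ?a # [Inr b]"
      by simp
    then obtain u v where g': "filter ?P (gap j) = u @ ?a # ?a # v" by blast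
    have "filter ?P (gap_word t) = (Inr b # concat (replicate j [?a, Inr b]) @ u) @ ?a # ?a #
        (v @ concat (replicate (t - Suc j) [Inr b, ?a]))"
      unfolding f g' by simp
    from not_alternate_if_square[OF _ this] E show ?thesis by simp
  qed
qed

text \<open>For different pairs, \<open>gap i\<close> has two copies of its letter with none of the
  other pair between them. Within a pair, the border reads \<open>x y x y\<close> while every other
  occurrence reads \<open>y x\<close>, so a repetition arises where they meet. This takes a second
  pair: for \<open>t = 1\<close> only \<open>x y x y\<close> remains.\<close>

lemma not_alternate_gap_word_Inl:
  assumes t: "t \<ge> 2" and ij: "i < t" "j < t" "(i, r) \<noteq> (j, s)"
  shows "\<not> alternate (Inl (i, r)) (Inl (j, s)) (gap_word t)"
proof (cases "i = j")
  case False
  let ?P = "\<lambda>z :: 'b letter. z = Inl (i, r) \<or> z = Inl (j, s)"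
  have "filter ?P (gap i) = [Inl (i, r), Inl (i, r)]"
    using False by (cases r) (auto simp: gap_def filter_cell_Nil)
  moreover obtain u v where "gap_word t = u @ gap i @ v"
  proof
    show "gap_word t =
       (rev (cell 0 False False @ cell 0 True False @ cell 0 True True @ cell 0 False True) @
        concat (map (\<lambda>i. others t i @ gap i) [0..<i]) @ others t i) @ gap i @
       others t (Suc i) @ concat (map (\<lambda>i. gap i @ others t (Suc i)) [Suc i..<t])"
      unfolding gap_word_split[OF ij(1)] by (simp only: append.assoc)
  qed
  ultimately have "filter ?P (gap_word t) = filter ?P u @ Inl (i, r) # Inl (i, r) # filter ?P v"
    by simp
  from not_alternate_if_square[OF _ this] ij(3) show ?thesis by simp
next
  case True
  let ?x = "Inl (j, False) :: 'b letter" and ?y = "Inl (j, True) :: 'b letter"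
  let ?P = "\<lambda>z. z = ?x \<or> z = ?y"
  have o: "filter ?P (others t i) = (if j = i \<or> Suc j = i then [] else [?y, ?x])" for i
    by (subst filter_others_pair[of j]) (use ij in auto)
  have g: "filter ?P (gap i) = (if i = j then [?x, ?y, ?x, ?y] else [])" for i
    by (auto simp: gap_def filter_cell_Nil)
  have 1: "filter ?P (concat (map (\<lambda>i. others t i @ gap i) [0..<j])) =
      concat (replicate j [?y, ?x])"
    unfolding filter_concat map_map
    by (subst concat_map_const[where c = "[?y, ?x]"]) (auto simp: o g)
  have 2: "filter ?P (concat (map (\<lambda>i. gap i @ others t (Suc i)) [Suc j..<t])) =
      concat (replicate (t - Suc j) [?y, ?x])"
    unfolding filter_concat map_map
    by (subst concat_map_const[where c = "[?y, ?x]"]) (auto simp: o g)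
  have f: "filter ?P (gap_word t) = concat (replicate j [?y, ?x]) @ [?x, ?y, ?x, ?y] @
      concat (replicate (t - Suc j) [?y, ?x])"
    unfolding gap_word_split[OF ij(2)] filter_append 1 2
    by (simp add: o g filter_cell_Nil flip: rev_filter)
  have "\<exists>u c v. filter ?P (gap_word t) = u @ c # c # v"
  proof (cases j)
    case 0
    \<comment> \<open>The first pair has no earlier occurrence, so the repetition \<open>y y\<close>
      is sought to the right of the border; for later pairs \<open>x x\<close> appears to its
      left.\<close>
    with t have "t - Suc j = Suc (t - 2)" by simp
    with f 0 have "filter ?P (gap_word t) =
        [?x, ?y, ?x] @ ?y # ?y # ?x # concat (replicate (t - 2) [?y, ?x])" by simp
    then show ?thesis by blast
  next
    case (Suc k)
    then have "concat (replicate j [?y, ?x]) = concat (replicate k [?y, ?x]) @ [?y, ?x]"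
      by (simp only: concat_replicate_Suc)
    with f have "filter ?P (gap_word t) = (concat (replicate k [?y, ?x]) @ [?y]) @ ?x # ?x #
        [?y, ?x, ?y] @ concat (replicate (t - Suc j) [?y, ?x])" by simp
    then show ?thesis by blast
  qed
  then obtain u c v where "filter ?P (gap_word t) = u @ c # c # v" by blast
  from not_alternate_if_square[OF _ this] have "\<not> alternate ?x ?y (gap_word t)" by simp
  with True ij(3) show ?thesis by (cases r; cases s) (auto simp: alternate_commute)
qed

lemma not_alternate_gap_word_Inr:
  assumes "t > 0" "b \<in> set bs" "b \<noteq> c"
  shows "\<not> alternate (Inr b) (Inr c) (gap_word t)"
proof -
  let ?P = "\<lambda>z :: 'b letter. z = Inr b \<or> z = Inr c"
  let ?s = "cell 0 False False @ cell 0 True False @ cell 0 True True @ cell 0 False True"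
  \<comment> \<open>The cells of \<open>gap 0\<close> are separated only by pair letters, which are
    filtered out; the initial row and the first border then join to
    \<open>rev ?s @ ?s\<close>.\<close>
  have "filter ?P (gap 0) = filter ?P ?s" by (simp add: gap_def)
  then obtain v' where v': "filter ?P (gap_word t) = filter ?P (rev ?s @ ?s) @ v'"
    unfolding gap_word_split[OF assms(1)] filter_append by (simp add: filter_others_Nil)
  have "Inr b \<in> set ?s" using assms(2) by (auto simp: cell_def)
  from filter_rev_append_self(1)[OF this, of ?P]
  obtain u d v where "filter ?P (rev ?s @ ?s) = u @ d # d # v" by blast
  then have "filter ?P (gap_word t) = u @ d # d # (v @ v')" by (simp only: v' append.assoc append_Cons)
  from not_alternate_if_square[OF _ this] show ?thesis using \<open>b \<noteq> c\<close> by simp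
qed

section \<open>The word for a single pair\<close>

lemma count_small_word:
  assumes "distinct bs" "b \<in> set bs"
  shows "count_list small_word (Inl (0, s)) = 2" "count_list small_word (Inr b) = 2"
proof -
  have [simp]: "count_list (rev xs) z = count_list xs z" for xs :: "'b letter list" and z
    by (induction xs) (auto simp: count_list_append)
  have [simp]: "count_list (cell 0 p q) (Inl x) = 0" for p q x
    by (auto simp: count_list_0_iff cell_def)
  have [simp]: "count_list (cell 0 p q) (Inr b) =
      (if E (0, False) b = p \<and> E (0, True) b = q then 1 else 0)" for p q
    using filter_cell[OF assms, of "\<lambda>z. z = Inr b" 0 p q]
      count_list_filter_eq[of "\<lambda>z. z = Inr b" "Inr b" "cell 0 p q"] by auto
  show "count_list small_word (Inl (0, s)) = 2"
    by (cases s) (auto simp: small_word_def count_list_append)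
  show "count_list small_word (Inr b) = 2"
    by (auto simp: small_word_def count_list_append)
qed

lemma alternate_small_word_iff:
  assumes bs: "distinct bs" "b \<in> set bs"
  shows "alternate (Inl (0, s)) (Inr b) small_word \<longleftrightarrow> E (0, s) b"
proof -
  let ?a = "Inl (0, s) :: 'b letter" and ?P = "\<lambda>z :: 'b letter. z = Inl (0, s) \<or> z = Inr b"
  note c = filter_cell_Inl_Inr[OF bs]
  have "filter ?P small_word \<in> {alternating_word ?a (Inr b) 4, alternating_word (Inr b) ?a 4}"
    if "E (0, s) b"
    using that by (cases s; cases "E (0, False) b"; cases "E (0, True) b")
      (auto simp: small_word_def c numeral_eq_Suc simp flip: rev_filter)
  moreover have "filter ?P small_word \<in>
      {[] @ ?a # ?a # [Inr b, Inr b], [Inr b, Inr b] @ ?a # ?a # []}"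
    if "\<not> E (0, s) b"
    using that by (cases s; cases "E (0, False) b"; cases "E (0, True) b")
      (auto simp: small_word_def c simp flip: rev_filter)
  ultimately show ?thesis
    using not_alternate_if_square[of ?a "Inr b" small_word] unfolding alternate_def
    by (metis (no_types, lifting) Inl_Inr_False insertE singletonD)
qed

lemma not_alternate_small_word_Inl:
  assumes "r \<noteq> s"
  shows "\<not> alternate (Inl (0, r)) (Inl (0, s)) small_word"
proof -
  let ?x = "Inl (0, False) :: 'b letter" and ?y = "Inl (0, True) :: 'b letter"
  have "filter (\<lambda>z. z = ?x \<or> z = ?y) small_word = [] @ ?x # ?x # [?y, ?y]"
    by (simp add: small_word_def filter_cell_Nil flip: rev_filter)
  then have "\<not> alternate ?x ?y small_word"
    using not_alternate_if_square[of ?x ?y] by blast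
  with assms show ?thesis by (cases r; cases s) (auto simp: alternate_commute)
qed

text \<open>Between a cell and its reverse stand only pair letters. The last of \<open>b\<close> and
  \<open>c\<close> in the cell of \<open>b\<close> therefore meets its own copy, whether or not
  \<open>c\<close> lies in that cell.\<close>

lemma not_alternate_small_word_Inr:
  assumes "b \<in> set bs" "b \<noteq> c"
  shows "\<not> alternate (Inr b) (Inr c) small_word"
proof -
  let ?P = "\<lambda>z :: 'b letter. z = Inr b \<or> z = Inr c"
  let ?s = "\<lambda>p q. cell 0 p q"
  define W where "W p q = filter ?P (?s p q @ rev (?s p q))" for p q
  have F: "filter ?P small_word = W True False @ W True True @ W False True @ W False False"
    by (simp add: small_word_def W_def)
  have sub: "\<exists>u v. filter ?P small_word = u @ W p q @ v" for p q
  proof (cases p; cases q)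
    assume "p" "q"
    then have "filter ?P small_word = W True False @ W p q @ W False True @ W False False"
      using F by simp
    then show ?thesis by blast
  next
    assume "p" "\<not> q"
    then have "filter ?P small_word = [] @ W p q @ W True True @ W False True @ W False False"
      using F by simp
    then show ?thesis by blast
  next
    assume "\<not> p" "q"
    then have "filter ?P small_word = (W True False @ W True True) @ W p q @ W False False"
      using F by simp
    then show ?thesis by blast
  next
    assume "\<not> p" "\<not> q"
    then have "filter ?P small_word = (W True False @ W True True @ W False True) @ W p q @ []"
      using F by simp
    then show ?thesis by blast
  qed
  have "Inr b \<in> set (?s (E (0, False) b) (E (0, True) b))" using assms(1) by (auto simp: cell_def)
  from filter_rev_append_self(2)[OF this, of ?P]
  obtain u d v where "W (E (0, False) b) (E (0, True) b) = u @ d # d # v"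
    unfolding W_def by auto
  moreover obtain u' v' where "filter ?P small_word = u' @ W (E (0, False) b) (E (0, True) b) @ v'"
    using sub by blast
  ultimately have "filter ?P small_word = (u' @ u) @ d # d # (v @ v')" by simp
  from not_alternate_if_square[OF _ this] show ?thesis using \<open>b \<noteq> c\<close> by simp
qed

section \<open>From words to bipartite graphs\<close>

lemma pair_word_exists:
  assumes bs: "distinct bs" "bs \<noteq> []" and t: "t > 0"
  obtains w :: "'b letter list" where
    "\<And>j s. j < t \<Longrightarrow> count_list w (Inl (j, s)) = t + 1"
    "\<And>b. b \<in> set bs \<Longrightarrow> count_list w (Inr b) = t + 1"
    "\<And>j s b. j < t \<Longrightarrow> b \<in> set bs \<Longrightarrow> alternate (Inl (j, s)) (Inr b) w \<longleftrightarrow> E (j, s) b"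
    "\<And>i r j s. i < t \<Longrightarrow> j < t \<Longrightarrow> (i, r) \<noteq> (j, s) \<Longrightarrow> \<not> alternate (Inl (i, r)) (Inl (j, s)) w"
    "\<And>b c. b \<in> set bs \<Longrightarrow> b \<noteq> c \<Longrightarrow> \<not> alternate (Inr b) (Inr c) w"
proof -
  \<comment> \<open>Multiplicities of pair letters in both words were computed alongside some vertex
    of the list, so one is fixed here.\<close>
  obtain b0 where b0: "b0 \<in> set bs" using bs(2) by (metis list.set_sel(1))
  show ?thesis
  proof (cases "t = 1")
    case True
    have 2: "t + 1 = 2" and 0: "j < t \<longleftrightarrow> j = 0" for j using True by auto
    show ?thesis
      by (rule that[of small_word], unfold 2 0)
        (use b0 count_small_word[OF bs(1)] alternate_small_word_iff[OF bs(1)]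
          not_alternate_small_word_Inl not_alternate_small_word_Inr in auto)
  next
    case False
    show ?thesis
    proof (rule that[of "gap_word t"])
      show "count_list (gap_word t) (Inl (j, s)) = t + 1" if "j < t" for j s
        using count_gap_word(1)[OF bs(1) b0 that] .
      show "count_list (gap_word t) (Inr b) = t + 1" if "b \<in> set bs" for b
        using count_gap_word(2)[OF bs(1) that t] .
    qed (use False t bs(1) in
        \<open>auto simp: alternate_gap_word_iff not_alternate_gap_word_Inl not_alternate_gap_word_Inr\<close>)
  qed
qed

end

lemma representation_number_le:
  "uniform_word k w \<Longrightarrow> represents w G \<Longrightarrow> representation_number G \<le> enat k"
  unfolding representation_number_def by (rule Inf_lower) blast

lemma bipartite_representation_number_le:
  fixes G :: "('a, 'b) pre_digraph"
  assumes "graph G" and bip: "bipartition G A B" and "B \<noteq> {}"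
    and card: "card A \<le> 2 * t" and t: "t > 0"
  shows "representation_number G \<le> enat (t + 1)"
proof -
  interpret graph G by fact
  have V: "verts G = A \<union> B" "A \<inter> B = {}"
    and AB: "\<And>u v. u \<rightarrow>\<^bsub>G\<^esub> v \<Longrightarrow> (u \<in> A \<and> v \<in> B) \<or> (u \<in> B \<and> v \<in> A)"
    using bip unfolding bipartition_def by blast+
  have fin: "finite A" "finite B" using V(1) finite_verts by auto
  have "card A \<le> card ({..<t} \<times> (UNIV :: bool set))"
    using card by (simp add: card_cartesian_product)
  with fin(1) obtain e where e: "e ` A \<subseteq> {..<t} \<times> (UNIV :: bool set)" "inj_on e A"
    using card_le_inj[of A "{..<t} \<times> (UNIV :: bool set)"] by auto
  obtain bs where bs: "set bs = B" "distinct bs" using finite_distinct_list[OF fin(2)] by blast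
  \<comment> \<open>A letter that encodes no vertex of \<open>A\<close> counts as adjacent to
    nothing; it is deleted again in the transfer.\<close>
  define E where "E p b \<longleftrightarrow> (\<exists>a \<in> A. e a = p \<and> a \<rightarrow>\<^bsub>G\<^esub> b)" for p b
  have E: "E (e a) b \<longleftrightarrow> a \<rightarrow>\<^bsub>G\<^esub> b" if "a \<in> A" for a b
    using that inj_on_eq_iff[OF e(2)] by (auto simp: E_def)
  have et: "fst (e a) < t" if "a \<in> A" for a using that e(1) by (auto simp: image_subset_iff mem_Times_iff)
  have "bs \<noteq> []" using bs \<open>B \<noteq> {}\<close> by auto
  from pair_word_exists[OF bs(2) this t, of E] obtain w where
    w: "\<And>j s. j < t \<Longrightarrow> count_list w (Inl (j, s)) = t + 1"
    "\<And>b. b \<in> set bs \<Longrightarrow> count_list w (Inr b) = t + 1"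
    "\<And>j s b. j < t \<Longrightarrow> b \<in> set bs \<Longrightarrow> alternate (Inl (j, s)) (Inr b) w \<longleftrightarrow> E (j, s) b"
    "\<And>i r j s. i < t \<Longrightarrow> j < t \<Longrightarrow> (i, r) \<noteq> (j, s) \<Longrightarrow> \<not> alternate (Inl (i, r)) (Inl (j, s)) w"
    "\<And>b c. b \<in> set bs \<Longrightarrow> b \<noteq> c \<Longrightarrow> \<not> alternate (Inr b) (Inr c) w"
    by blast
  have adj_sym: "x \<rightarrow>\<^bsub>G\<^esub> y \<longleftrightarrow> y \<rightarrow>\<^bsub>G\<^esub> x" for x y
    using sym_arcs by (auto simp: symmetric_def dest: symD)
  define g where "g v = (if v \<in> A then Inl (e v) else Inr v)" for v
  have gA: "g v = Inl (fst (e v), snd (e v))" if "v \<in> A" for v using that by (simp add: g_def)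
  have gB: "g v = Inr v" if "v \<in> B" for v using that V(2) by (auto simp: g_def)
  have inj: "inj_on g (verts G)"
    using e(2) by (auto simp: inj_on_def g_def)
  have AB_iff: "x \<rightarrow>\<^bsub>G\<^esub> y \<longleftrightarrow> alternate (g x) (g y) w" if "x \<in> A" "y \<in> B" for x y
    using that w(3)[OF et[OF that(1)]] E[OF that(1)] bs(1)
    by (metis gA gB prod.collapse)
  have "\<exists>w'. uniform_word (t + 1) w' \<and> represents w' G"
  proof (rule represents_transfer[OF inj])
    show "count_list w (g x) = t + 1" if "x \<in> verts G" for x
      using that V(1) w(1)[OF et, of x "snd (e x)"] w(2) bs(1) gA gB by auto
    fix x y assume "x \<in> verts G" "y \<in> verts G" and ne: "x \<noteq> y"
    then consider "x \<in> A" "y \<in> A" | "x \<in> A" "y \<in> B" | "x \<in> B" "y \<in> A" | "x \<in> B" "y \<in> B"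
      using V(1) by blast
    then show "x \<rightarrow>\<^bsub>G\<^esub> y \<longleftrightarrow> alternate (g x) (g y) w"
    proof cases
      case 1
      then have "e x \<noteq> e y" using inj_on_eq_iff[OF e(2)] ne by simp
      then have "\<not> alternate (g x) (g y) w"
        using w(4)[OF et[OF 1(1)] et[OF 1(2)], of "snd (e x)" "snd (e y)"] 1 by (simp add: g_def)
      moreover have "\<not> x \<rightarrow>\<^bsub>G\<^esub> y" using 1 AB[of x y] V(2) by blast
      ultimately show ?thesis by simp
    next
      case 2
      then show ?thesis by (rule AB_iff)
    next
      case 3
      then show ?thesis
        using AB_iff[of y x] adj_sym[of x y]
        by (simp add: alternate_commute[of "g x"])
    next
      case 4
      then have "\<not> alternate (g x) (g y) w" using w(5) ne bs(1) by (simp add: gB)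
      moreover have "\<not> x \<rightarrow>\<^bsub>G\<^esub> y" using 4 AB[of x y] V(2) by blast
      ultimately show ?thesis by simp
    qed
  qed simp
  then show ?thesis using representation_number_le by blast
qed

lemma representation_number_single_vertex:
  assumes "verts G = {v}"
  shows "representation_number G \<le> enat 1"
proof (rule representation_number_le)
  show "uniform_word 1 [v]" by (simp add: uniform_word_def)
  show "represents [v] G" using assms by (simp add: represents_def)
qed

theorem theorem2:
  fixes G :: "('a, 'b) pre_digraph" and A B :: "'a set" and m n :: nat
  assumes "graph G"
    and "Digraph_Component.connected G"
    and "reduced G"
    and "bipartition G A B"
    and "card A = m" and "card B = n" and "m \<le> n"
  shows "(n \<ge> m + 3 \<longrightarrow>
            representation_number G \<le> enat (nat \<lceil>real (m + n) / 4\<rceil>)) \<and>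
         (even m \<and> n \<in> {m + 1, m + 2} \<longrightarrow>
            representation_number G \<le> enat (nat \<lceil>real (m + n) / 4\<rceil>))"
proof -
  interpret graph G by fact
  have bound: "representation_number G \<le> enat (nat \<lceil>real (m + n) / 4\<rceil>)"
    \<comment> \<open>Each of the two cases of the theorem implies this disjunction, so one argument
      serves both.\<close>
    if mn: "n \<ge> m + 3 \<or> even m \<and> n \<ge> m + 1"
  proof (cases "m = 0")
    case True
    have V: "verts G = A \<union> B" and AB: "\<And>u v. u \<rightarrow>\<^bsub>G\<^esub> v \<Longrightarrow> u \<in> A \<or> v \<in> A"
      using assms(4) unfolding bipartition_def by blast+
    have "A = {}" using True assms(5) V finite_verts by auto
    with AB have "neighborhood G u = {}" for u by (auto simp: neighborhood_def)
    with assms(3) have "\<forall>u \<in> verts G. \<forall>v \<in> verts G. u = v" by (auto simp: reduced_def)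
    moreover have "B \<noteq> {}" using mn assms(6) by auto
    ultimately obtain v where "verts G = {v}" using V \<open>A = {}\<close> by blast
    then have "representation_number G \<le> enat 1" by (rule representation_number_single_vertex)
    also have "enat 1 \<le> enat (nat \<lceil>real (m + n) / 4\<rceil>)"
      using mn by (simp add: le_nat_iff) linarith
    finally show ?thesis .
  next
    case False
    define t where "t = (m + 1) div 2"
    have "B \<noteq> {}" using mn assms(6) by auto
    then have "representation_number G \<le> enat (t + 1)"
      using False assms(5)
      by (intro bipartite_representation_number_le[OF assms(1,4)]) (auto simp: t_def)
    also have "enat (t + 1) \<le> enat (nat \<lceil>real (m + n) / 4\<rceil>)"
    proof -
      \<comment> \<open>Here \<open>4 * t\<close> is \<open>2 * m\<close> for even \<open>m\<close>
        and \<open>2 * m + 2\<close> for odd \<open>m\<close>; the odd case relies on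
        \<open>n >= m + 3\<close>. Strictness is what lifts the ceiling from \<open>t\<close> to
        \<open>t + 1\<close>.\<close>
      have "4 * t < m + n" using mn by (auto simp: t_def elim!: evenE)
      then have "real (4 * t) < real (m + n)" by (simp only: of_nat_less_iff)
      then have "real t < real (m + n) / 4" by simp
      then show ?thesis by (simp only: enat_ord_simps) linarith
    qed
    finally show ?thesis .
  qed
  then show ?thesis by auto
qed

end
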